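(* Let $T_{ab}$ be a real symmetric tensor at a point of a spacetime of signature $(-+++)$, with Eulerian data $\rho_n$, $j$, $S_{ij}$ relative to a unit timelike normal $n^a$, $j\neq0$, and momentum direction $\hat\jmath^a=j^a/|j|$. Let $(n^a,\hat\jmath^a,\hat t^a,\hat z^a)$ be an orthonormal frame. Let $\hat\jmath^a$ fail to be a principal axis of the spatial stress $S_{ij}$, so that a transverse coupling $m=S(\hat\jmath,\hat t)$ enters the block of $T^a{}_b$ along $n^a$, $\hat\jmath^a$ and the coupled transverse axis $\hat t^a$; and let the remaining spatial axis $\hat z^a$ decouple from that block, $S(\hat\jmath,\hat z)=S(\hat t,\hat z)=0$. (This decoupling is a hypothesis and not a normalisation: without it the characteristic polynomial of $T^a{}_b$ is quartic and the cubic discriminant of the block does not decide the type.) Write $S_x=S(\hat\jmath,\hat\jmath)$, $S_y=S(\hat t,\hat t)$, and let $D(\rho_n,S_x,S_y,|j|,m)$ be the cubic discriminant of the characteristic polynomial of the block $$\begin{pmatrix}-\rho_n&|j|&0\\-|j|&S_x&m\\0&m&S_y\end{pmatrix}.$$ Then: (a) $D$ is even in $m$ and satisfies $D|_{m=0}=(\mathrm{minor})^2\,\Delta$, where $\mathrm{minor}=S_xS_y-S_y^2-|j|^2+(S_x-S_y)\rho_n$ and $\Delta=(\rho_n+S_x)^2-4|j|^2$. (b) Consequently a transverse complex pair (Type IV) opens where $D<0$, its boundary lying on the algebraic surface $D=0$. (c) This pair can open with $\Delta\ge0$: the momentum discriminant (the condition $\Delta<0$) is sufficient under the splitting hypothesis,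 and in no case necessary, for Type IV. (d) On the witness family $\rho_n=S_x=1$, $|j|=\tfrac12$, $S_y=0$, the transverse pair is complex on the band $m_\star<|m|<m_2$ between the two positive roots of $D$ (as a function of $m$), with $m_\star\approx0.782$ and $m_2\approx2.015$; and at $m=1$ an Eulerian null vector of the orthonormal frame, i.e. $k^a=n^a+\hat s^a$ with $\hat s^a$ a unit spatial vector orthogonal to $n^a$, exhibits the null violation directly: $T_{ab}k^ak^b<0$.
   Context: Eulerian data: with $h^a{}_b=\delta^a{}_b+n^an_b$ the projector orthogonal to the unit timelike vector $n^a$, $\rho_n=T_{ab}n^an^b$, $j^i=-h^i{}_aT^a{}_bn^b$, $S_{ij}=h_i{}^ah_j{}^bT_{ab}$. For spatial vectors $v,w$, $S(v,w)=S_{ij}v^iw^j$. A principal axis of $S_{ij}$ is an eigenvector of $S$ with respect to the spatial metric. The splitting hypothesis is that $\hat\jmath^a$ is a principal axis of $S_{ij}$, so that the plane spanned by $n^a$ and $\hat\jmath^a$ decouples from the other two axes. In the frame $(n,\hat\jmath,\hat t,\hat z)$ of the claim, the mixed tensor $T^a{}_b$ is the displayed $3\times3$ block together with the decoupled real eigenvalue $S(\hat z,\hat z)$. For a cubic $\lambda^3+c_2\lambda^2+c_1\lambda+c_0$ the discriminant is $18c_2c_1c_0-4c_2^3c_0+c_2^2c_1^2-4c_1^3-27c_0^2$. A tensor $T^a{}_b$ is (Hawking--Ellis) Type IV if it has a pair of non-real complex-conjugate eigenvalues. $\Delta$ is called the momentum discriminant. *)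

theory Defs
  imports "HOL-Analysis.Analysis"
begin

section \<open>Characteristic polynomials and complex eigenvalues of real matrices\<close>

definition charpoly :: "real^'n^'n \<Rightarrow> real poly" where
  "charpoly A = det (\<chi> i j. (if i = j then [:0, 1:] else 0) - [:A $ i $ j:])"

definition complex_eigenvalue :: "real^'n^'n \<Rightarrow> complex \<Rightarrow> bool" where
  "complex_eigenvalue A l \<longleftrightarrow>
     (\<exists>v. v \<noteq> 0 \<and> (\<chi> i j. complex_of_real (A $ i $ j)) *v v = l *s v)"

definition complex_pair :: "real^'n^'n \<Rightarrow> bool" where
  "complex_pair A \<longleftrightarrow>
     (\<exists>l. Im l \<noteq> 0 \<and> complex_eigenvalue A l \<and> complex_eigenvalue A (cnj l))"

text \<open>The discriminant of a monic cubic \<open>x^3 + c2 x^2 + c1 x + c0\<close>.\<close>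

definition cubic_discriminant :: "real poly \<Rightarrow> real" where
  "cubic_discriminant p =
     (let c2 = coeff p 2; c1 = coeff p 1; c0 = coeff p 0 in
      18 * c2 * c1 * c0 - 4 * c2^3 * c0 + c2\<^sup>2 * c1\<^sup>2 - 4 * c1^3 - 27 * c0\<^sup>2)"

section \<open>Tensors at a point of a spacetime\<close>

text \<open>
  The tangent space is \<open>real^4\<close> in arbitrary, not necessarily orthonormal, coordinates.
  Vectors \<open>v\<close> carry an upper index; \<open>g\<close> and \<open>T\<close> are the matrices of the doubly covariant
  components \<open>g_ab\<close>, \<open>T_ab\<close>; mixed tensors carry the upper index on the row.
\<close>

definition minkowski :: "real^4^4" where
  "minkowski = (\<chi> i j. if i = j then (if i = 1 then -1 else 1) else 0)"

definition lorentzian :: "real^4^4 \<Rightarrow> bool" where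
  "lorentzian g \<longleftrightarrow> transpose g = g \<and>
     (\<exists>P. invertible P \<and> transpose P ** g ** P = minkowski)"

definition bilin :: "real^4^4 \<Rightarrow> real^4 \<Rightarrow> real^4 \<Rightarrow> real" where
  "bilin B v w = (\<Sum>a\<in>UNIV. \<Sum>b\<in>UNIV. B $ a $ b * v $ a * w $ b)"

text \<open>\<open>T^a_b = g^ac T_cb\<close>\<close>

definition mixed :: "real^4^4 \<Rightarrow> real^4^4 \<Rightarrow> real^4^4" where
  "mixed g T = matrix_inv g ** T"

definition type_IV :: "real^4^4 \<Rightarrow> real^4^4 \<Rightarrow> bool" where
  "type_IV g T \<longleftrightarrow> complex_pair (mixed g T)"

text \<open>\<open>h^a_b = \<delta>^a_b + n^a n_b\<close>\<close>

definition projector :: "real^4^4 \<Rightarrow> real^4 \<Rightarrow> real^4^4" where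
  "projector g n = (\<chi> a b. (if a = b then 1 else 0) + n $ a * (g *v n) $ b)"

text \<open>\<open>h_ab = g_ab + n_a n_b\<close>\<close>

definition spatial_metric :: "real^4^4 \<Rightarrow> real^4 \<Rightarrow> real^4^4" where
  "spatial_metric g n = (\<chi> a b. g $ a $ b + (g *v n) $ a * (g *v n) $ b)"

definition energy :: "real^4^4 \<Rightarrow> real^4 \<Rightarrow> real" where
  "energy T n = bilin T n n"

definition momentum :: "real^4^4 \<Rightarrow> real^4^4 \<Rightarrow> real^4 \<Rightarrow> real^4" where
  "momentum g T n = - (projector g n *v (mixed g T *v n))"

text \<open>\<open>S_ij = h_i^a h_j^b T_ab\<close>; for the symmetric tensor \<open>h_ab\<close> one has \<open>h_i^a = h^a_i\<close>.\<close>

definition stress :: "real^4^4 \<Rightarrow> real^4^4 \<Rightarrow> real^4 \<Rightarrow> real^4^4" where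
  "stress g T n = transpose (projector g n) ** T ** projector g n"

definition momentum_norm :: "real^4^4 \<Rightarrow> real^4^4 \<Rightarrow> real^4 \<Rightarrow> real" where
  "momentum_norm g T n =
     sqrt (bilin (spatial_metric g n) (momentum g T n) (momentum g T n))"

definition momentum_dir :: "real^4^4 \<Rightarrow> real^4^4 \<Rightarrow> real^4 \<Rightarrow> real^4" where
  "momentum_dir g T n = (1 / momentum_norm g T n) *s momentum g T n"

definition principal_axis :: "real^4^4 \<Rightarrow> real^4^4 \<Rightarrow> real^4 \<Rightarrow> real^4 \<Rightarrow> bool" where
  "principal_axis g T n v \<longleftrightarrow> v \<noteq> 0 \<and> bilin g n v = 0 \<and>
     (\<exists>\<mu>. stress g T n *v v = \<mu> *s (spatial_metric g n *v v))"

definition orthonormal_frame :: "real^4^4 \<Rightarrow> real^4 \<Rightarrow> real^4 \<Rightarrow> real^4 \<Rightarrow> real^4 \<Rightarrow> bool" where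
  "orthonormal_frame g n x t z \<longleftrightarrow>
     bilin g n n = -1 \<and> bilin g x x = 1 \<and> bilin g t t = 1 \<and> bilin g z z = 1 \<and>
     bilin g n x = 0 \<and> bilin g n t = 0 \<and> bilin g n z = 0 \<and>
     bilin g x t = 0 \<and> bilin g x z = 0 \<and> bilin g t z = 0"

section \<open>The transversally coupled configuration\<close>

definition coupled_config ::
    "real^4^4 \<Rightarrow> real^4 \<Rightarrow> real^4 \<Rightarrow> real^4 \<Rightarrow> real^4 \<Rightarrow> real^4^4 \<Rightarrow> bool" where
  "coupled_config g n x t z T \<longleftrightarrow>
     transpose T = T \<and>
     momentum g T n \<noteq> 0 \<and>
     x = momentum_dir g T n \<and>
     orthonormal_frame g n x t z \<and>
     \<not> principal_axis g T n x \<and>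
     bilin (stress g T n) x z = 0 \<and>
     bilin (stress g T n) t z = 0"

text \<open>Parameter tuples are \<open>(\<rho>, Sx, Sy, J, m)\<close>, with \<open>J\<close> standing for \<open>|j|\<close>.\<close>

type_synonym params = "real \<times> real \<times> real \<times> real \<times> real"

definition params_of :: "real^4^4 \<Rightarrow> real^4 \<Rightarrow> real^4 \<Rightarrow> real^4 \<Rightarrow> real^4^4 \<Rightarrow> params" where
  "params_of g n x t T =
     (energy T n, bilin (stress g T n) x x, bilin (stress g T n) t t,
      momentum_norm g T n, bilin (stress g T n) x t)"

fun block :: "params \<Rightarrow> real^3^3" where
  "block (\<rho>, Sx, Sy, J, m) =
     vector [vector [-\<rho>, J, 0],
             vector [-J, Sx, m],
             vector [0, m, Sy]]"

definition D :: "params \<Rightarrow> real" where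
  "D p = cubic_discriminant (charpoly (block p))"

definition minor :: "real \<Rightarrow> real \<Rightarrow> real \<Rightarrow> real \<Rightarrow> real" where
  "minor \<rho> Sx Sy J = Sx * Sy - Sy\<^sup>2 - J\<^sup>2 + (Sx - Sy) * \<rho>"

definition momentum_discriminant :: "real \<Rightarrow> real \<Rightarrow> real \<Rightarrow> real" where
  "momentum_discriminant \<rho> Sx J = (\<rho> + Sx)\<^sup>2 - 4 * J\<^sup>2"

end

theory Submission
  imports Defs
begin

text \<open>
  In the tetrad \<open>(n, x, t, z)\<close> the mixed tensor is the block plus the real eigenvalue on \<open>z\<close>,
  so a complex pair of the tensor is one of the block: a complex eigenvector, written as two real
  vectors, has no \<open>z\<close>-component. For the block everything is about a real cubic: splitting off
  a real root \<open>r\<close> leaves a quadratic \<open>q\<close> with \<open>disc = disc(q) q(r)\<^sup>2\<close>, so the cubic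
  discriminant is negative exactly when there is a non-real root. At \<open>m = 0\<close> the real root is
  \<open>Sy\<close>, which gives the factorisation of \<open>D\<close> there. On the witness family \<open>D\<close> is a cubic in
  \<open>m\<^sup>2\<close> with one negative and two positive roots.
\<close>

section \<open>Real matrices with a complex pair\<close>

text \<open>An eigenvector is a kernel vector of the matrix minus \<open>mat l\<close>, so
  singularity is the common meaning; the determinant form is the one that can be expanded for the
  block.\<close>

lemma complex_eigenvalue_iff_det:
  "complex_eigenvalue A l \<longleftrightarrow> det ((\<chi> i j. complex_of_real (A $ i $ j)) - mat l) = 0"
proof -
  let ?C = "\<chi> i j. complex_of_real (A $ i $ j)"
  have mat: "mat l *v v = l *s v" for v :: "complex^'n"
    by (simp add: vec_eq_iff matrix_vector_mult_def mat_def if_distrib[of "\<lambda>c. c * _"] cong: if_cong)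
  have ker: "?C *v v = l *s v \<longleftrightarrow> (?C - mat l) *v v = 0" for v
    by (simp only: matrix_vector_mult_diff_rdistrib mat right_minus_eq)
  have "(\<exists>v. v \<noteq> 0 \<and> (?C - mat l) *v v = 0) \<longleftrightarrow> \<not> invertible (?C - mat l)"
    by (auto simp: invertible_left_inverse matrix_left_invertible_ker)
  then show ?thesis
    unfolding complex_eigenvalue_def ker by (simp add: invertible_det_nz)
qed

lemma complex_eigenvalue_cnj:
  assumes "complex_eigenvalue A l"
  shows "complex_eigenvalue A (cnj l)"
proof -
  from assms obtain v where v: "v \<noteq> 0" "(\<chi> i j. complex_of_real (A $ i $ j)) *v v = l *s v"
    unfolding complex_eigenvalue_def by blast
  have eq: "(\<Sum>j\<in>UNIV. complex_of_real (A $ i $ j) * v $ j) = l * v $ i" for i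
    using v(2) by (simp add: vec_eq_iff matrix_vector_mult_def)
  have "(\<Sum>j\<in>UNIV. complex_of_real (A $ i $ j) * cnj (v $ j)) = cnj l * cnj (v $ i)" for i
    using arg_cong[OF eq, of cnj i] by simp
  then have "(\<chi> i j. complex_of_real (A $ i $ j)) *v (\<chi> j. cnj (v $ j)) = cnj l *s (\<chi> j. cnj (v $ j))"
    by (simp add: vec_eq_iff matrix_vector_mult_def)
  moreover have "(\<chi> j. cnj (v $ j)) \<noteq> 0"
    using v(1) by (auto simp: vec_eq_iff)
  ultimately show ?thesis
    unfolding complex_eigenvalue_def by blast
qed

text \<open>A real matrix commutes with conjugation, so a single non-real eigenvalue already brings
  its conjugate.\<close>

lemma complex_pair_iff: "complex_pair A \<longleftrightarrow> (\<exists>l. Im l \<noteq> 0 \<and> complex_eigenvalue A l)"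
  unfolding complex_pair_def using complex_eigenvalue_cnj by blast

text \<open>Real and imaginary parts of the eigenvector equation for \<open>p + i q\<close> and
  \<open>a + i b\<close>. In this form a complex pair can be carried along real linear maps between
  spaces of different dimension.\<close>

lemma complex_pair_iff_real:
  "complex_pair A \<longleftrightarrow>
     (\<exists>a b p q. b \<noteq> 0 \<and> (p \<noteq> 0 \<or> q \<noteq> 0) \<and>
        A *v p = a *s p - b *s q \<and> A *v q = b *s p + a *s q)"
    (is "_ \<longleftrightarrow> ?R")
proof
  assume "complex_pair A"
  then obtain l v where l: "Im l \<noteq> 0" and v: "v \<noteq> 0"
    and ev: "(\<chi> i j. complex_of_real (A $ i $ j)) *v v = l *s v"
    unfolding complex_pair_iff complex_eigenvalue_def by blast
  have eq: "(\<Sum>j\<in>UNIV. complex_of_real (A $ i $ j) * v $ j) = l * v $ i" for i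
    using ev by (simp add: vec_eq_iff matrix_vector_mult_def)
  let ?p = "\<chi> j. Re (v $ j)" and ?q = "\<chi> j. Im (v $ j)"
  have "A *v ?p = Re l *s ?p - Im l *s ?q"
    using arg_cong[OF eq, of Re] by (simp add: vec_eq_iff matrix_vector_mult_def)
  moreover have "A *v ?q = Im l *s ?p + Re l *s ?q"
    using arg_cong[OF eq, of Im] by (simp add: vec_eq_iff matrix_vector_mult_def algebra_simps)
  moreover have "?p \<noteq> 0 \<or> ?q \<noteq> 0"
    using v by (auto simp: vec_eq_iff complex_eq_iff)
  ultimately show ?R
    using l by blast
next
  assume ?R
  then obtain a b p q where b: "b \<noteq> 0" and nz: "p \<noteq> 0 \<or> q \<noteq> 0"
    and p: "A *v p = a *s p - b *s q" and q: "A *v q = b *s p + a *s q"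
    by blast
  let ?v = "\<chi> j. Complex (p $ j) (q $ j)"
  have "(\<chi> i j. complex_of_real (A $ i $ j)) *v ?v = Complex a b *s ?v"
    using p q by (simp add: vec_eq_iff matrix_vector_mult_def complex_eq_iff algebra_simps)
  moreover have "?v \<noteq> 0"
    using nz by (auto simp: vec_eq_iff complex_eq_iff)
  ultimately have "complex_eigenvalue A (Complex a b)"
    unfolding complex_eigenvalue_def by blast
  then show "complex_pair A"
    unfolding complex_pair_iff using b by (metis complex.sel(2))
qed

section \<open>The discriminant of a real cubic\<close>

text \<open>The cubic is \<open>(l - r) * (l^2 + u * l + w)\<close>. Its discriminant is that of the
  quadratic times the squared resultant of the two factors, and this resultant is the quadratic
  evaluated at \<open>r\<close>.\<close>

lemma cubic_disc_factor:
  fixes r u w :: "real"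
  assumes "c2 = u - r" "c1 = w - r * u" "c0 = - r * w"
  shows "18 * c2 * c1 * c0 - 4 * c2^3 * c0 + c2\<^sup>2 * c1\<^sup>2 - 4 * c1^3 - 27 * c0\<^sup>2 =
    (u\<^sup>2 - 4 * w) * (r\<^sup>2 + u * r + w)\<^sup>2"
  unfolding assms by algebra

lemma real_cubic_root:
  fixes a b c :: real
  obtains r where "r ^ 3 + a * r\<^sup>2 + b * r + c = 0"
proof -
  \<comment> \<open>\<open>M\<close> is so large that the lower terms at \<open>y = M\<close> and
    \<open>y = -M\<close> are at most \<open>M^3\<close> in absolute value; the leading term then
    decides the sign at both ends.\<close>
  define M where "M = 1 + \<bar>a\<bar> + \<bar>b\<bar> + \<bar>c\<bar>"
  have M: "M \<ge> 1" unfolding M_def by simp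
  have bd: "\<bar>a * y\<^sup>2 + b * y + c\<bar> \<le> M ^ 3" if "\<bar>y\<bar> = M" for y
  proof -
    have M2: "1 \<le> M\<^sup>2" "M \<le> M\<^sup>2"
      using M by (simp_all add: one_le_power self_le_power)
    have y2: "y\<^sup>2 = M\<^sup>2" using that by (metis power2_abs)
    have "\<bar>a * y\<^sup>2 + b * y + c\<bar> \<le> \<bar>a\<bar> * M\<^sup>2 + \<bar>b\<bar> * M + \<bar>c\<bar>"
      using abs_triangle_ineq[of "a * y\<^sup>2 + b * y" c] abs_triangle_ineq[of "a * y\<^sup>2" "b * y"]
      by (simp add: abs_mult that y2)
    also have "\<dots> \<le> \<bar>a\<bar> * M\<^sup>2 + \<bar>b\<bar> * M\<^sup>2 + \<bar>c\<bar> * M\<^sup>2"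
      using M2 by (intro add_mono mult_left_mono) (auto simp: mult_le_cancel_left1)
    also have "\<dots> \<le> M * M\<^sup>2"
      unfolding M_def by (simp add: algebra_simps)
    finally show ?thesis by (simp add: power3_eq_cube power2_eq_square)
  qed
  let ?f = "\<lambda>y. y ^ 3 + a * y\<^sup>2 + b * y + c"
  have "?f (-M) \<le> 0" "0 \<le> ?f M"
    using bd[of M] bd[of "-M"] M by (auto simp: power3_eq_cube abs_le_iff)
  then have "\<exists>y\<ge>-M. y \<le> M \<and> ?f y = 0"
    by (intro IVT') (use M in \<open>auto intro!: continuous_intros\<close>)
  then show thesis using that by blast
qed

text \<open>The squared factor could spoil the sign only by vanishing, but a quadratic with negative
  discriminant has no real root, so its value at \<open>r\<close> is not zero.\<close>

lemma cubic_nonreal_root_iff: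
  fixes c2 c1 c0 :: real
  shows "(\<exists>l. Im l \<noteq> 0 \<and> l ^ 3 + of_real c2 * l\<^sup>2 + of_real c1 * l + of_real c0 = 0) \<longleftrightarrow>
    18 * c2 * c1 * c0 - 4 * c2^3 * c0 + c2\<^sup>2 * c1\<^sup>2 - 4 * c1^3 - 27 * c0\<^sup>2 < 0"
    (is "?L \<longleftrightarrow> ?disc < 0")
proof -
  obtain r where r: "r ^ 3 + c2 * r\<^sup>2 + c1 * r + c0 = 0"
    using real_cubic_root .
  define u where "u = c2 + r"
  define w where "w = c1 + r * u"
  have c: "c2 = u - r" "c1 = w - r * u" by (simp_all add: u_def w_def)
  have c0: "c0 = - r * w" using r unfolding u_def w_def by (simp add: power3_eq_cube power2_eq_square algebra_simps)
  have disc: "?disc = (u\<^sup>2 - 4 * w) * (r\<^sup>2 + u * r + w)\<^sup>2"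
    by (rule cubic_disc_factor[OF c c0])
  have fac: "l ^ 3 + of_real c2 * l\<^sup>2 + of_real c1 * l + of_real c0 =
      (l - of_real r) * (l\<^sup>2 + of_real u * l + of_real w)" for l :: complex
    unfolding c c0 by (simp add: power3_eq_cube power2_eq_square algebra_simps)
  have sq: "4 * (y\<^sup>2 + u * y + w) = (2 * y + u)\<^sup>2 - (u\<^sup>2 - 4 * w)" for y :: real
    by (simp add: power2_eq_square algebra_simps)
  have "?L \<longleftrightarrow> (\<exists>l. Im l \<noteq> 0 \<and> l\<^sup>2 + of_real u * l + of_real w = 0)"
    unfolding fac by auto
  also have "\<dots> \<longleftrightarrow> u\<^sup>2 - 4 * w < 0"
  proof
    assume "\<exists>l. Im l \<noteq> 0 \<and> l\<^sup>2 + of_real u * l + of_real w = 0"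
    then obtain l where l: "Im l \<noteq> 0" "l\<^sup>2 + of_real u * l + of_real w = 0" by blast
    \<comment> \<open>The two parts of the equation identify \<open>-u\<close> and \<open>w\<close>
      as the sum and the product of \<open>l\<close> and \<open>cnj l\<close>, so the discriminant
      is \<open>- 4 * (Im l)^2\<close>.\<close>
    have "(2 * Re l + u) * Im l = 0" "(Re l)\<^sup>2 - (Im l)\<^sup>2 + u * Re l + w = 0"
      using l(2) by (simp_all add: complex_eq_iff power2_eq_square algebra_simps)
    then have "u = - 2 * Re l" "w = (Re l)\<^sup>2 + (Im l)\<^sup>2"
      using l(1) by (simp_all add: eq_neg_iff_add_eq_0 add.commute power2_eq_square, algebra)
    then show "u\<^sup>2 - 4 * w < 0" using l(1) by (simp add: power_mult_distrib)
  next
    assume neg: "u\<^sup>2 - 4 * w < 0"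
    define s where "s = sqrt (4 * w - u\<^sup>2)"
    have s: "s\<^sup>2 = 4 * w - u\<^sup>2" "s \<noteq> 0" using neg by (simp_all add: s_def)
    have "(Complex (- u / 2) (s / 2))\<^sup>2 + of_real u * Complex (- u / 2) (s / 2) + of_real w = 0"
      using s(1) by (simp add: complex_eq_iff power2_eq_square field_simps)
    then show "\<exists>l. Im l \<noteq> 0 \<and> l\<^sup>2 + of_real u * l + of_real w = 0"
      using s(2) by (metis complex.sel(2) divide_eq_0_iff zero_neq_numeral)
  qed
  also have "\<dots> \<longleftrightarrow> ?disc < 0"
  proof
    assume neg: "u\<^sup>2 - 4 * w < 0"
    have "0 < 4 * (r\<^sup>2 + u * r + w)" unfolding sq using neg zero_le_power2[of "2 * r + u"] by linarith
    then show "?disc < 0" unfolding disc using neg by (simp add: mult_less_0_iff)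
  qed (auto simp: disc mult_less_0_iff)
  finally show ?thesis .
qed

section \<open>The coupled block\<close>

lemma charpoly_block:
  "charpoly (block (\<rho>, Sx, Sy, J, m)) =
     [: J\<^sup>2 * - Sy + \<rho> * (Sx * Sy - m\<^sup>2),
        J\<^sup>2 + Sx * Sy - m\<^sup>2 - \<rho> * (Sx + Sy), \<rho> - Sx - Sy, 1 :]"
  unfolding charpoly_def by (simp add: det_3 power2_eq_square algebra_simps)

lemma D_expand:
  "D (\<rho>, Sx, Sy, J, m) =
     (let c2 = \<rho> - Sx - Sy; c1 = J\<^sup>2 + Sx * Sy - m\<^sup>2 - \<rho> * (Sx + Sy);
          c0 = J\<^sup>2 * - Sy + \<rho> * (Sx * Sy - m\<^sup>2) in
      18 * c2 * c1 * c0 - 4 * c2^3 * c0 + c2\<^sup>2 * c1\<^sup>2 - 4 * c1^3 - 27 * c0\<^sup>2)"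
  unfolding D_def charpoly_block cubic_discriminant_def
  by (simp add: Let_def numeral_2_eq_2)

lemma complex_pair_block_iff: "complex_pair (block p) \<longleftrightarrow> D p < 0"
proof -
  obtain \<rho> Sx Sy J m where p: "p = (\<rho>, Sx, Sy, J, m)" by (cases p)
  have "complex_eigenvalue (block p) l \<longleftrightarrow>
      l ^ 3 + of_real (\<rho> - Sx - Sy) * l\<^sup>2
        + of_real (J\<^sup>2 + Sx * Sy - m\<^sup>2 - \<rho> * (Sx + Sy)) * l
        + of_real (J\<^sup>2 * - Sy + \<rho> * (Sx * Sy - m\<^sup>2)) = 0" for l
  proof -
    \<comment> \<open>The minus sign comes from the odd dimension: the determinant is of the block
      minus \<open>l\<close>, not of \<open>l\<close> minus the block.\<close>
    have "det ((\<chi> i j. complex_of_real (block p $ i $ j)) - mat l) =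
      - (l ^ 3 + of_real (\<rho> - Sx - Sy) * l\<^sup>2
        + of_real (J\<^sup>2 + Sx * Sy - m\<^sup>2 - \<rho> * (Sx + Sy)) * l
        + of_real (J\<^sup>2 * - Sy + \<rho> * (Sx * Sy - m\<^sup>2)))"
      by (simp add: p det_3 mat_def power2_eq_square power3_eq_cube algebra_simps)
    then show ?thesis by (simp only: complex_eigenvalue_iff_det neg_equal_0_iff_equal)
  qed
  then show ?thesis
    unfolding complex_pair_iff by (simp only: cubic_nonreal_root_iff p D_expand Let_def)
qed

text \<open>The coupling enters the characteristic polynomial only through
  \<open>m^2\<close>.\<close>

lemma D_even: "D (\<rho>, Sx, Sy, J, -m) = D (\<rho>, Sx, Sy, J, m)"
  by (simp add: D_expand)

text \<open>Without coupling the cubic is \<open>l - Sy\<close> times the quadratic of the momentum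
  plane; the latter has the momentum discriminant as its discriminant and takes the value
  \<open>- minor\<close> at \<open>Sy\<close>.\<close>

lemma D_zero_coupling:
  "D (\<rho>, Sx, Sy, J, 0) = (minor \<rho> Sx Sy J)\<^sup>2 * momentum_discriminant \<rho> Sx J"
proof -
  have "D (\<rho>, Sx, Sy, J, 0) =
      ((\<rho> - Sx)\<^sup>2 - 4 * (J\<^sup>2 - \<rho> * Sx)) * (Sy\<^sup>2 + (\<rho> - Sx) * Sy + (J\<^sup>2 - \<rho> * Sx))\<^sup>2"
    unfolding D_expand Let_def by (rule cubic_disc_factor) (simp_all add: algebra_simps)
  also have "Sy\<^sup>2 + (\<rho> - Sx) * Sy + (J\<^sup>2 - \<rho> * Sx) = - minor \<rho> Sx Sy J"
    by (simp add: minor_def power2_eq_square algebra_simps)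
  also have "(\<rho> - Sx)\<^sup>2 - 4 * (J\<^sup>2 - \<rho> * Sx) = momentum_discriminant \<rho> Sx J"
    by (simp add: momentum_discriminant_def power2_eq_square algebra_simps)
  finally show ?thesis by (simp add: mult.commute)
qed

text \<open>By continuity of \<open>D\<close> the set where \<open>D < 0\<close> is open and its
  closure stays in \<open>D \<le> 0\<close>, so only \<open>D = 0\<close> is left for the
  frontier.\<close>

lemma frontier_complex_pair_block: "frontier {p. complex_pair (block p)} \<subseteq> {p. D p = 0}"
proof -
  have eq: "D = (\<lambda>p. D (fst p, fst (snd p), fst (snd (snd p)), fst (snd (snd (snd p))), snd (snd (snd (snd p)))))"
    by simp
  have cont: "continuous_on UNIV D"
    by (subst eq, unfold D_expand Let_def) (intro continuous_intros)
  have "open {p. D p < 0}" "closed {p. D p \<le> 0}"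
    using cont by (auto intro!: open_Collect_less closed_Collect_le)
  moreover from this have "closure {p. D p < 0} \<subseteq> {p. D p \<le> 0}"
    by (intro closure_minimal) auto
  ultimately show ?thesis
    unfolding frontier_def complex_pair_block_iff by (auto simp: interior_open less_le)
qed

text \<open>
  \<open>Sy\<close> is taken to be the root of the decoupled quadratic factor nearest to \<open>-\<rho>\<close>, so that
  the uncoupled block has a double root. With \<open>u = \<lambda> - Sy\<close> the characteristic polynomial becomes
  \<open>u\<^sup>2 (u - d) - m\<^sup>2 (u + e)\<close>, where \<open>d e \<ge> 0\<close>, \<open>e \<noteq> 0\<close> makes the double root split
  into a complex pair.
\<close>

lemma D_neg_exists:
  assumes "J > 0" "momentum_discriminant \<rho> Sx J \<ge> 0"
  obtains Sy m where "m \<noteq> 0" "D (\<rho>, Sx, Sy, J, m) < 0"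
proof -
  let ?\<Delta> = "momentum_discriminant \<rho> Sx J"
  \<comment> \<open>The sign is chosen so that \<open>d\<close> and \<open>e\<close> both follow the
    sign of \<open>\<rho> + Sx\<close>, whence \<open>d * e \<ge> 0\<close>.\<close>
  define \<sigma> where "\<sigma> = (if \<rho> + Sx \<ge> 0 then - 1 else 1 :: real)"
  define Sy where "Sy = (Sx - \<rho> + \<sigma> * sqrt ?\<Delta>) / 2"
  define d where "d = - \<sigma> * sqrt ?\<Delta>"
  define e where "e = Sy + \<rho>"
  have \<sigma>: "\<sigma>\<^sup>2 = 1" by (simp add: \<sigma>_def)
  have d2: "d\<^sup>2 = (\<rho> + Sx)\<^sup>2 - 4 * J\<^sup>2"
    using assms(2) \<sigma> by (simp add: d_def power_mult_distrib momentum_discriminant_def)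
  have e2: "2 * e = \<rho> + Sx - d" by (simp add: e_def Sy_def d_def field_simps)
  \<comment> \<open>Strict because \<open>J > 0\<close>; this keeps \<open>e\<close> away from
    zero.\<close>
  have dlt: "\<bar>d\<bar> < \<bar>\<rho> + Sx\<bar>"
    by (rule power2_less_imp_less) (use d2 assms(1) in simp_all)
  have e0: "e \<noteq> 0" using e2 dlt by auto
  have de: "d * e \<ge> 0"
  proof (cases "\<rho> + Sx \<ge> 0")
    case True
    then have "d \<ge> 0" using assms(2) by (simp add: d_def \<sigma>_def)
    then show ?thesis using e2 dlt True by auto
  next
    case False
    then have "d \<le> 0" using assms(2) by (simp add: d_def \<sigma>_def)
    then show ?thesis using e2 dlt False by (auto intro: mult_nonpos_nonpos)
  qed
  \<comment> \<open>Everything is expressed by \<open>Sy\<close>, \<open>d\<close> and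
    \<open>e\<close>. A discriminant depends only on differences of roots, so the shift
    \<open>Sy\<close> drops out of \<open>Dm\<close>.\<close>
  have sh: "\<rho> = e - Sy" "Sx = Sy + e + d"  "J\<^sup>2 = e * (e + d)"
  proof -
    show "\<rho> = e - Sy" by (simp add: e_def)
    then show Sx: "Sx = Sy + e + d" using e2 by simp
    show "J\<^sup>2 = e * (e + d)" using d2 unfolding Sx \<open>\<rho> = e - Sy\<close> by (simp add: power2_eq_square algebra_simps)
  qed
  have Dm: "D (\<rho>, Sx, Sy, J, m) =
     - 18 * d * (m\<^sup>2)\<^sup>2 * e - 4 * d ^ 3 * m\<^sup>2 * e + d\<^sup>2 * (m\<^sup>2)\<^sup>2 + 4 * (m\<^sup>2) ^ 3 - 27 * (m\<^sup>2)\<^sup>2 * e\<^sup>2" for m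
    unfolding D_expand Let_def sh(3) unfolding sh(1,2) by algebra
  show thesis
  proof (cases "d = 0")
    case True
    \<comment> \<open>For \<open>d = 0\<close> the discriminant is
      \<open>m^4 * (4 * m^2 - 27 * e^2)\<close>, and \<open>m = e\<close> makes the bracket
      negative.\<close>
    have "D (\<rho>, Sx, Sy, J, e) = - 23 * (e\<^sup>2) ^ 3"
      unfolding Dm True by (simp add: power2_eq_square power3_eq_cube)
    then show ?thesis using that[of e Sy] e0 by simp
  next
    case False
    with de e0 have pos: "d * e > 0" by (auto simp: less_le)
    \<comment> \<open>The choice \<open>m^2 = d * e\<close> makes all terms homogeneous in
      \<open>d\<close> and \<open>e\<close>; after taking out \<open>(d * e)^2\<close> the positive
      contributions are absorbed by the negative ones.\<close>
    have "D (\<rho>, Sx, Sy, J, sqrt (d * e)) = - ((d * e)\<^sup>2 * (3 * d\<^sup>2 + 14 * (d * e) + 27 * e\<^sup>2))"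
      unfolding Dm using de by (simp add: power2_eq_square power3_eq_cube algebra_simps)
    also have "\<dots> < 0"
    proof -
      have "0 < 3 * d\<^sup>2 + 14 * (d * e) + 27 * e\<^sup>2"
        using pos zero_le_power2[of d] zero_le_power2[of e] by linarith
      moreover have "0 < (d * e)\<^sup>2" using pos by (intro zero_less_power)
      ultimately show ?thesis by (simp del: power_mult_distrib)
    qed
    finally show ?thesis
      by (rule that[rotated]) (use real_sqrt_gt_zero[OF pos] in linarith)
  qed
qed

section \<open>The band of complex pairs on the witness family\<close>

lemma witness_band:
  "\<exists>m\<^sub>1 m\<^sub>2. m\<^sub>1 < m\<^sub>2 \<and> {m. 0 < m \<and> D (1, 1, 0, 1/2, m) = 0} = {m\<^sub>1, m\<^sub>2} \<and>
     \<bar>m\<^sub>1 - 0.782\<bar> < 0.0005 \<and> \<bar>m\<^sub>2 - 2.015\<bar> < 0.0005 \<and>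
     (\<forall>m. D (1, 1, 0, 1/2, m) < 0 \<longleftrightarrow> m\<^sub>1 < \<bar>m\<bar> \<and> \<bar>m\<bar> < m\<^sub>2)"
proof -
  \<comment> \<open>This is \<open>D\<close> in the variable \<open>y = m^2\<close>. The block is
    trace-free here, so the discriminant reduces to
    \<open>4 * (y + 3/4)^3 - 27 * y^2\<close>.\<close>
  define f where "f = (\<lambda>y::real. 4 * y ^ 3 - 18 * y\<^sup>2 + 27 / 4 * y + 27 / 16)"
  have Df: "D (1, 1, 0, 1/2, m) = f (m\<^sup>2)" for m
    unfolding D_expand Let_def f_def by (simp add: field_simps power2_eq_square power3_eq_cube)
  have ivt: "\<exists>y>a. y < b \<and> f y = 0" if "a < b" "f a * f b < 0" for a b
  proof -
    have cont: "continuous_on {a..b} f" unfolding f_def by (intro continuous_intros)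
    have "\<exists>y\<ge>a. y \<le> b \<and> f y = 0"
      using that IVT'[of f a 0 b] IVT2'[of f b 0 a] cont by (force simp: mult_less_0_iff)
    then obtain y where "a \<le> y" "y \<le> b" "f y = 0" by blast
    moreover have "y \<noteq> a" "y \<noteq> b" using \<open>f y = 0\<close> that(2) by auto
    ultimately show ?thesis by (intro exI[of _ y]) auto
  qed
  \<comment> \<open>The negative root is not the square of any \<open>m\<close>; it completes the
    list of three roots, and so the factorisation of \<open>f\<close>.\<close>
  obtain y0 where y0: "-1 < y0" "y0 < 0" "f y0 = 0"
    using ivt[of "-1" 0] by (auto simp: f_def)
  \<comment> \<open>The brackets for \<open>y1\<close> and \<open>y2\<close> are the squares of
    0.782 and 2.015 shifted by 0.0005 either way.\<close>
  obtain y1 where y1: "0.7815\<^sup>2 < y1" "y1 < 0.7825\<^sup>2" "f y1 = 0"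
    using ivt[of "0.7815\<^sup>2" "0.7825\<^sup>2"] by (auto simp: f_def field_simps power2_eq_square power3_eq_cube)
  obtain y2 where y2: "2.0145\<^sup>2 < y2" "y2 < 2.0155\<^sup>2" "f y2 = 0"
    using ivt[of "2.0145\<^sup>2" "2.0155\<^sup>2"] by (auto simp: f_def field_simps power2_eq_square power3_eq_cube)
  have y12: "0 < y1" "y1 < y2"
    using y1 y2 by (auto simp: power2_eq_square field_simps)
  have q: "f y - f z = (y - z) * (4 * (y\<^sup>2 + y * z + z\<^sup>2) - 18 * (y + z) + 27 / 4)" for y z
    unfolding f_def by (simp add: power2_eq_square power3_eq_cube field_simps)
  \<comment> \<open>At two distinct roots the cofactor in \<open>q\<close> vanishes. Subtracting the
    two relations gives the sum of the roots, which leads to the full factorisation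
    \<open>fac\<close>.\<close>
  have "4 * (y1\<^sup>2 + y1 * y0 + y0\<^sup>2) - 18 * (y1 + y0) + 27 / 4 = 0"
       "4 * (y2\<^sup>2 + y2 * y0 + y0\<^sup>2) - 18 * (y2 + y0) + 27 / 4 = 0"
    using q[of y1 y0] q[of y2 y0] y0 y1(3) y2(3) y12 by auto
  note qq = this
  then have "(y2 - y1) * (4 * (y0 + y1 + y2) - 18) = 0"
    by algebra
  then have s: "y0 + y1 + y2 = 9 / 2" using y12 by simp
  have fac: "f y = 4 * (y - y0) * (y - y1) * (y - y2)" for y
  proof -
    have y0': "y0 = 9 / 2 - y1 - y2" using s by simp
    have "f y = f y - f y1" using y1 by simp
    also have "\<dots> = 4 * (y - y0) * (y - y1) * (y - y2)"
      using qq(1) unfolding q y0' by algebra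
    finally show ?thesis .
  qed
  have neg: "f (m\<^sup>2) < 0 \<longleftrightarrow> y1 < m\<^sup>2 \<and> m\<^sup>2 < y2" for m
  proof -
    have "0 < m\<^sup>2 - y0" using y0 zero_le_power2[of m] by linarith
    then show ?thesis unfolding fac using y12 by (auto simp: mult_less_0_iff zero_less_mult_iff)
  qed
  have zero: "f (m\<^sup>2) = 0 \<longleftrightarrow> m\<^sup>2 = y1 \<or> m\<^sup>2 = y2" for m
  proof -
    have "0 < m\<^sup>2 - y0" using y0 zero_le_power2[of m] by linarith
    then show ?thesis unfolding fac by auto
  qed
  have bounds: "0.7815 < sqrt y1" "sqrt y1 < 0.7825" "2.0145 < sqrt y2" "sqrt y2 < 2.0155"
    using y1 y2 y12 by (intro real_less_rsqrt real_less_lsqrt; simp)+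
  have sqrt_iff: "sqrt y < \<bar>m\<bar> \<longleftrightarrow> y < m\<^sup>2" "\<bar>m\<bar> < sqrt y \<longleftrightarrow> m\<^sup>2 < y" for y m :: real
    by (simp_all only: real_sqrt_abs[symmetric] real_sqrt_less_iff)
  have "{m. 0 < m \<and> D (1, 1, 0, 1/2, m) = 0} = {sqrt y1, sqrt y2}"
    unfolding Df zero using y12 by (auto simp: real_sqrt_unique)
  moreover have "\<bar>sqrt y1 - 0.782\<bar> < 0.0005" "\<bar>sqrt y2 - 2.015\<bar> < 0.0005"
    using bounds unfolding abs_less_iff by simp_all
  moreover have "\<forall>m. D (1, 1, 0, 1/2, m) < 0 \<longleftrightarrow> sqrt y1 < \<bar>m\<bar> \<and> \<bar>m\<bar> < sqrt y2"
    by (simp only: Df neg sqrt_iff simp_thms)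
  moreover have "sqrt y1 < sqrt y2" using y12 by simp
  ultimately show ?thesis by blast
qed

section \<open>Tensors in an orthonormal tetrad\<close>

lemma bilin_eq_inner: "bilin B v w = v \<bullet> (B *v w)"
  by (simp add: bilin_def inner_vec_def matrix_vector_mult_def sum_distrib_left mult_ac)

lemma bilin_linear [simp]:
  "bilin B (u + v) w = bilin B u w + bilin B v w"
  "bilin B (u - v) w = bilin B u w - bilin B v w"
  "bilin B (- v) w = - bilin B v w"
  "bilin B (c *s v) w = c * bilin B v w"
  "bilin B 0 w = 0"
  "bilin B w (u + v) = bilin B w u + bilin B w v"
  "bilin B w (u - v) = bilin B w u - bilin B w v"
  "bilin B w (- v) = - bilin B w v"
  "bilin B w (c *s v) = c * bilin B w v"
  "bilin B w 0 = 0"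
  by (simp_all add: bilin_def sum.distrib sum_subtractf sum_negf sum_distrib_left algebra_simps)

lemma bilin_commute: "transpose B = B \<Longrightarrow> bilin B v w = bilin B w v"
  unfolding bilin_eq_inner by (metis dot_lmul_matrix inner_commute transpose_matrix_vector)

text \<open>The tensor product of two covectors, from which tensors with prescribed frame components
  are built.\<close>

definition outer :: "real^4 \<Rightarrow> real^4 \<Rightarrow> real^4^4" where
  "outer u w = (\<chi> a b. u $ a * w $ b)"

lemma bilin_outer [simp]: "bilin (outer u w) v v' = (v \<bullet> u) * (v' \<bullet> w)"
  by (simp add: bilin_def outer_def inner_vec_def sum_product mult_ac)

lemma bilin_matrix_linear [simp]:
  "bilin (A + B) v w = bilin A v w + bilin B v w"
  "bilin (c *\<^sub>R A) v w = c * bilin A v w"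
  by (simp_all add: bilin_def sum.distrib sum_distrib_left algebra_simps)

section \<open>Frame components and index raising\<close>

locale orthonormal_tetrad =
  fixes g :: "real^4^4" and n x t z :: "real^4"
  assumes metric_sym: "transpose g = g"
    and frame: "orthonormal_frame g n x t z"
begin

lemmas metric_commute = bilin_commute[OF metric_sym]

lemma frame_products [simp]:
  "bilin g n n = -1" "bilin g x x = 1" "bilin g t t = 1" "bilin g z z = 1"
  "bilin g n x = 0" "bilin g n t = 0" "bilin g n z = 0"
  "bilin g x t = 0" "bilin g x z = 0" "bilin g t z = 0"
  "bilin g x n = 0" "bilin g t n = 0" "bilin g z n = 0"
  "bilin g t x = 0" "bilin g z x = 0" "bilin g z t = 0"
  using frame metric_commute unfolding orthonormal_frame_def by metis+

text \<open>Stacking the frame as rows turns its Gram matrix into a matrix product, to which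
  determinants apply.\<close>

definition rows :: "real^4^4" where
  "rows = (\<chi> i. if i = 1 then n else if i = 2 then x else if i = 3 then t else z)"

lemma rows_nth: "rows $ 1 = n" "rows $ 2 = x" "rows $ 3 = t" "rows $ 4 = z"
  by (simp_all add: rows_def)

lemma gram: "rows ** g ** transpose rows = minkowski"
proof -
  have "(rows ** g ** transpose rows) $ i $ j = bilin g (rows $ i) (rows $ j)" for i j
    unfolding bilin_def matrix_matrix_mult_def transpose_def
    by (simp add: sum_distrib_right mult_ac) (subst sum.swap, simp add: sum_distrib_left mult_ac)
  moreover have "bilin g (rows $ i) (rows $ j) = minkowski $ i $ j" for i j
    using exhaust_4[of i] exhaust_4[of j] by (auto simp: minkowski_def rows_nth)
  ultimately show ?thesis
    by (simp only: vec_eq_iff simp_thms)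
qed

text \<open>The Gram matrix is the Minkowski matrix, whose determinant is not zero, so no factor of
  it can be singular: the frame is a basis and the metric is nondegenerate.\<close>

lemma det_nz: "det rows \<noteq> 0" "det g \<noteq> 0"
proof -
  have "det minkowski \<noteq> 0"
    by (subst det_diagonal) (simp_all add: minkowski_def)
  then have "det rows * det g * det rows \<noteq> 0"
    unfolding gram[symmetric] by (simp add: det_mul det_transpose)
  then show "det rows \<noteq> 0" "det g \<noteq> 0" by auto
qed

lemma covector_eqI:
  assumes "n \<bullet> u = n \<bullet> w" "x \<bullet> u = x \<bullet> w" "t \<bullet> u = t \<bullet> w" "z \<bullet> u = z \<bullet> w"
  shows "u = w"
proof -
  have "rows *v (u - w) = 0"
    using assms by (simp add: vec_eq_iff forall_4 matrix_vector_mul_component rows_nth inner_diff_right)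
  moreover have "\<exists>B. B ** rows = mat 1"
    using det_nz(1) by (metis invertible_det_nz invertible_left_inverse)
  ultimately have "u - w = 0"
    by (simp only: matrix_left_invertible_ker)
  then show ?thesis by simp
qed

text \<open>Lowering the index by the nondegenerate metric reduces this to covectors. Vector
  identities below are obtained by comparing these four products.\<close>

lemma vector_eqI:
  assumes "bilin g n u = bilin g n w" "bilin g x u = bilin g x w"
    "bilin g t u = bilin g t w" "bilin g z u = bilin g z w"
  shows "u = w"
proof -
  have "g *v u = g *v w"
    using assms unfolding bilin_eq_inner by (rule covector_eqI)
  then have "g *v (u - w) = 0" by (simp add: matrix_vector_mult_diff_distrib)
  moreover have "\<exists>B. B ** g = mat 1"
    using det_nz(2) by (metis invertible_det_nz invertible_left_inverse)
  ultimately have "u - w = 0"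
    by (simp only: matrix_left_invertible_ker)
  then show ?thesis by simp
qed

lemma frame_expansion:
  "v = - bilin g n v *s n + bilin g x v *s x + bilin g t v *s t + bilin g z v *s z"
  by (rule vector_eqI) simp_all

lemma bilin_mixed [simp]: "bilin g v (mixed g T *v w) = bilin T v w"
proof -
  have "invertible g" using det_nz(2) by (simp add: invertible_det_nz)
  \<comment> \<open>\<open>matrix_inv\<close> is defined by choice; invertibility of
    \<open>g\<close> makes the chosen matrix a genuine inverse.\<close>
  then have "g ** matrix_inv g = mat 1"
    unfolding invertible_def matrix_inv_def by (rule someI2_ex) simp
  then have "g *v (mixed g T *v w) = T *v w"
    by (simp add: mixed_def matrix_vector_mul_assoc matrix_mul_assoc)
  then show ?thesis by (simp add: bilin_eq_inner)
qed

lemma bilin_mixed_left: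
  assumes "transpose T = T"
  shows "bilin g (mixed g T *v v) w = bilin T v w"
  unfolding metric_commute[of _ w] bilin_mixed by (rule bilin_commute[OF assms])

lemma mixed_selfadjoint:
  assumes "transpose T = T"
  shows "bilin g v (mixed g T *v w) = bilin g (mixed g T *v v) w"
  by (simp add: bilin_mixed_left[OF assms])

section \<open>Projector, stress and momentum in the frame\<close>

lemma bilin_normal: "bilin g n v = (\<Sum>b\<in>UNIV. (g *v n) $ b * v $ b)"
  by (subst metric_commute) (simp add: bilin_eq_inner inner_vec_def mult_ac)

lemma matrix_vector_nth: "(A *v v) $ a = (\<Sum>b\<in>UNIV. A $ a $ b * v $ b)"
  by (simp add: matrix_vector_mult_def)

lemma projector_apply: "projector g n *v v = v + bilin g n v *s n"
proof -
  have "(projector g n *v v) $ a = (\<Sum>b\<in>UNIV. if a = b then v $ b else 0)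
      + (\<Sum>b\<in>UNIV. n $ a * ((g *v n) $ b * v $ b))" for a
    unfolding matrix_vector_nth[of "projector g n"] sum.distrib[symmetric]
    by (rule sum.cong) (simp_all add: projector_def algebra_simps)
  then show ?thesis
    by (simp add: vec_eq_iff bilin_normal sum_distrib_left[symmetric])
qed

lemma bilin_stress:
  "bilin (stress g T n) v w = bilin T (v + bilin g n v *s n) (w + bilin g n w *s n)"
proof -
  have "v \<bullet> (transpose P *v y) = (P *v v) \<bullet> y" for P :: "real^4^4" and y
    by (simp only: transpose_matrix_vector inner_commute[of v] dot_lmul_matrix inner_commute[of y])
  then have "bilin (stress g T n) v w = bilin T (projector g n *v v) (projector g n *v w)"
    by (simp only: stress_def bilin_eq_inner matrix_vector_mul_assoc[symmetric])
  then show ?thesis by (simp only: projector_apply)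
qed

lemma spatial_metric_apply: "spatial_metric g n *v v = g *v (v + bilin g n v *s n)"
proof -
  have "(spatial_metric g n *v v) $ a = (\<Sum>b\<in>UNIV. g $ a $ b * v $ b)
      + (\<Sum>b\<in>UNIV. (g *v n) $ a * ((g *v n) $ b * v $ b))" for a
    unfolding matrix_vector_nth[of "spatial_metric g n"] sum.distrib[symmetric]
    by (rule sum.cong) (simp_all add: spatial_metric_def algebra_simps)
  then show ?thesis
    by (simp add: vec_eq_iff bilin_normal sum_distrib_left[symmetric] matrix_vector_nth[of g v]
        matrix_vector_right_distrib vec.scale)
qed

lemma bilin_spatial_metric:
  "bilin (spatial_metric g n) v w = bilin g v w + bilin g n v * bilin g n w"
  unfolding bilin_eq_inner[of "spatial_metric g n"] spatial_metric_apply
  by (simp add: bilin_eq_inner[symmetric] metric_commute[of v n])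

lemma bilin_momentum:
  assumes "transpose T = T"
  shows "bilin g v (momentum g T n) = - bilin T v n - energy T n * bilin g v n"
  unfolding momentum_def energy_def projector_apply by simp

lemma momentum_orthogonal: "transpose T = T \<Longrightarrow> bilin g n (momentum g T n) = 0"
  by (simp add: bilin_momentum energy_def)

text \<open>The momentum is orthogonal to \<open>n\<close>, so its square is the sum of the squares
  of its three spatial components, and one of these is nonzero unless the momentum vanishes.\<close>

lemma momentum_norm_sq:
  assumes "transpose T = T"
  shows "(momentum_norm g T n)\<^sup>2 = bilin g (momentum g T n) (momentum g T n)"
    and "momentum g T n \<noteq> 0 \<Longrightarrow> momentum_norm g T n > 0"
proof -
  let ?j = "momentum g T n"
  have 0: "bilin g n ?j = 0" by (rule momentum_orthogonal[OF assms])
  have "bilin g ?j ?j = (bilin g x ?j)\<^sup>2 + (bilin g t ?j)\<^sup>2 + (bilin g z ?j)\<^sup>2"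
    by (subst (2) frame_expansion[of ?j])
      (simp add: 0 metric_commute[of ?j n] metric_commute[of ?j x] metric_commute[of ?j t]
        metric_commute[of ?j z] power2_eq_square)
  note eq = this
  show "(momentum_norm g T n)\<^sup>2 = bilin g ?j ?j"
    unfolding momentum_norm_def bilin_spatial_metric by (simp add: 0 eq)
  assume "?j \<noteq> 0"
  then have "bilin g x ?j \<noteq> 0 \<or> bilin g t ?j \<noteq> 0 \<or> bilin g z ?j \<noteq> 0"
    using vector_eqI[of ?j 0] 0 by auto
  then have "bilin g ?j ?j > 0"
    unfolding eq by (elim disjE) (simp_all add: add_pos_nonneg add_nonneg_pos)
  then show "momentum_norm g T n > 0"
    unfolding momentum_norm_def bilin_spatial_metric by (simp add: 0)
qed

lemma momentum_eq:
  assumes "transpose T = T" "momentum g T n \<noteq> 0"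
  shows "momentum g T n = momentum_norm g T n *s momentum_dir g T n"
  using momentum_norm_sq(2)[OF assms] by (simp add: momentum_dir_def vector_smult_assoc)

lemma momentum_dir_products:
  assumes "transpose T = T" "momentum g T n \<noteq> 0"
  shows "bilin g n (momentum_dir g T n) = 0"
    and "bilin g (momentum_dir g T n) (momentum_dir g T n) = 1"
  using momentum_norm_sq(2)[OF assms]
  by (simp_all add: momentum_dir_def momentum_orthogonal[OF assms(1)] power2_eq_square
      flip: momentum_norm_sq(1)[OF assms(1)])

text \<open>Splits the image of \<open>n\<close> along \<open>n\<close> and orthogonally to it; the
  orthogonal part is minus the momentum. This is the first column of the block.\<close>

lemma mixed_normal:
  assumes "transpose T = T" "momentum g T n \<noteq> 0"
  shows "mixed g T *v n = - energy T n *s n - momentum_norm g T n *s momentum_dir g T n"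
  unfolding momentum_eq[OF assms, symmetric]
  by (rule vector_eqI) (simp_all add: bilin_momentum[OF assms(1)] energy_def)

text \<open>
  The eigenvector is read off the plane block \<open>((-\<rho>, J), (-J, S))\<close>: for an eigenvalue \<open>\<lambda>\<close>
  it is \<open>(J, \<lambda> + \<rho>)\<close>, whose real and imaginary parts are \<open>?p\<close> and \<open>?q\<close> below.
\<close>

lemma principal_momentum_type_IV:
  assumes sym: "transpose T = T" and nz: "momentum g T n \<noteq> 0"
    and pa: "principal_axis g T n (momentum_dir g T n)"
    and neg: "momentum_discriminant (energy T n)
      (bilin (stress g T n) (momentum_dir g T n) (momentum_dir g T n)) (momentum_norm g T n) < 0"
  shows "type_IV g T"
proof -
  let ?e = "momentum_dir g T n" and ?J = "momentum_norm g T n" and ?\<rho> = "energy T n"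
  let ?S = "bilin (stress g T n) ?e ?e"
  note e [simp] = momentum_dir_products[OF sym nz]
  have e' [simp]: "bilin g ?e n = 0" using e(1) by (simp add: metric_commute)
  have J: "?J > 0" using momentum_norm_sq(2)[OF sym nz] .
  note Tn = mixed_normal[OF sym nz]
  obtain \<mu> where \<mu>: "stress g T n *v ?e = \<mu> *s (spatial_metric g n *v ?e)"
    using pa unfolding principal_axis_def by blast
  have st: "bilin (stress g T n) v ?e = \<mu> * (bilin g v ?e + bilin g n v * bilin g n ?e)" for v
    unfolding bilin_spatial_metric[symmetric] by (simp add: bilin_eq_inner \<mu> scalar_mult_eq_scaleR)
  have S: "?S = \<mu>" using st[of ?e] by simp
  have Tne: "bilin T n ?e = - ?J"
    unfolding bilin_mixed_left[OF sym, symmetric] Tn by simp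
  \<comment> \<open>The projector inside the stress adds a multiple of \<open>n\<close> to
    \<open>v\<close>, and \<open>Tne\<close> supplies its contribution.\<close>
  have Tve: "bilin T v ?e = \<mu> * bilin g v ?e + ?J * bilin g v n" for v
    using st[of v] Tne by (simp add: bilin_stress metric_commute[of v n] algebra_simps)
  have Te: "mixed g T *v ?e = ?J *s n + \<mu> *s ?e"
    by (rule vector_eqI) (simp_all add: Tve)
  \<comment> \<open>\<open>a\<close> and \<open>b\<close> are the real and imaginary part of an
    eigenvalue of the plane block; the momentum discriminant equals
    \<open>- 4 * b^2\<close>.\<close>
  define a where "a = (\<mu> - ?\<rho>) / 2"
  define b where "b = sqrt (4 * ?J\<^sup>2 - (?\<rho> + \<mu>)\<^sup>2) / 2"
  have b2: "4 * b\<^sup>2 = 4 * ?J\<^sup>2 - (?\<rho> + \<mu>)\<^sup>2" and b0: "b \<noteq> 0"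
    using neg unfolding momentum_discriminant_def S b_def by (simp_all add: power_divide)
  let ?p = "?J *s n + (a + ?\<rho>) *s ?e" and ?q = "b *s ?e"
  have "?p \<noteq> 0"
  proof
    assume "?p = 0"
    then have "bilin g n ?p = bilin g n 0" by simp
    then show False using J by simp
  qed
  moreover have "mixed g T *v ?p = a *s ?p - b *s ?q"
  proof -
    \<comment> \<open>The real part of the characteristic equation of the plane block.\<close>
    have key: "- (?J * ?J) + (a + ?\<rho>) * \<mu> = a * (a + ?\<rho>) - b * b"
      using b2 by (simp add: a_def power2_eq_square field_simps)
    have "mixed g T *v ?p = (?J * a) *s n + (- (?J * ?J) + (a + ?\<rho>) * \<mu>) *s ?e"
      by (simp only: matrix_vector_right_distrib vec.scale Tn Te) (simp add: vec_eq_iff algebra_simps)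
    also have "\<dots> = a *s ?p - b *s ?q"
      unfolding key by (simp add: vec_eq_iff algebra_simps)
    finally show ?thesis .
  qed
  moreover have "mixed g T *v ?q = b *s ?p + a *s ?q"
    by (simp add: Te vec_eq_iff vec.scale a_def field_simps)
  ultimately show ?thesis
    unfolding type_IV_def complex_pair_iff_real using b0 by blast
qed

section \<open>Coupled configurations and their reduction to the block\<close>

lemma configD:
  assumes cfg: "coupled_config g n x t z T" and par: "params_of g n x t T = (\<rho>, Sx, Sy, J, m)"
  shows "transpose T = T" "m \<noteq> 0"
    "bilin T n n = \<rho>" "bilin T n x = - J" "bilin T n t = 0" "bilin T n z = 0"
    "bilin T x n = - J" "bilin T t n = 0" "bilin T z n = 0"
    "bilin T x x = Sx" "bilin T t t = Sy" "bilin T x t = m" "bilin T t x = m"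
    "bilin T x z = 0" "bilin T t z = 0" "bilin T z x = 0" "bilin T z t = 0"
proof -
  show sym: "transpose T = T" using cfg by (simp add: coupled_config_def)
  note comm = bilin_commute[OF sym]
  have nz: "momentum g T n \<noteq> 0" and x: "momentum_dir g T n = x"
    and np: "\<not> principal_axis g T n x"
    and stress_z: "bilin (stress g T n) x z = 0" "bilin (stress g T n) t z = 0"
    using cfg unfolding coupled_config_def by metis+
  show xx: "bilin T x x = Sx" and tt: "bilin T t t = Sy" and xt: "bilin T x t = m"
    and rho: "bilin T n n = \<rho>"
    using par by (simp_all add: params_of_def bilin_stress energy_def)
  show xz: "bilin T x z = 0" and tz: "bilin T t z = 0"
    using stress_z by (simp_all add: bilin_stress)
  then show "bilin T z x = 0" "bilin T z t = 0" using comm by simp_all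
  show tx: "bilin T t x = m" using comm xt by simp
  have J: "momentum_norm g T n = J" using par by (simp add: params_of_def)
  have row: "bilin T n v = - \<rho> * bilin g n v - J * bilin g x v" for v
    unfolding bilin_mixed_left[OF sym, symmetric] mixed_normal[OF sym nz] x J
    by (simp add: rho energy_def)
  show "bilin T n x = - J" "bilin T n t = 0" "bilin T n z = 0" unfolding row by simp_all
  then show "bilin T x n = - J" "bilin T t n = 0" "bilin T z n = 0" using comm by simp_all
  show "m \<noteq> 0"
  \<comment> \<open>Without the coupling \<open>x\<close> would be a principal axis with eigenvalue
    \<open>Sx\<close>.\<close>
  proof
    assume "m = 0"
    then have "stress g T n *v x = Sx *s (spatial_metric g n *v x)"
      using xx xz tx comm[of z x]
      by (intro covector_eqI)
        (simp_all add: scalar_mult_eq_scaleR bilin_eq_inner[symmetric] bilin_stress bilin_spatial_metric)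
    moreover have "x \<noteq> 0" using frame_products(2) by force
    ultimately show False using np by (auto simp: principal_axis_def)
  qed
qed

text \<open>The columns of the block. Raising the index along the timelike \<open>n\<close> flips a
  sign, which is why \<open>J\<close> enters with opposite signs although \<open>T\<close> is
  symmetric.\<close>

lemma mixed_config:
  assumes cfg: "coupled_config g n x t z T" and par: "params_of g n x t T = (\<rho>, Sx, Sy, J, m)"
  shows "mixed g T *v n = - \<rho> *s n - J *s x"
    and "mixed g T *v x = J *s n + Sx *s x + m *s t"
    and "mixed g T *v t = m *s x + Sy *s t"
    and "mixed g T *v z = bilin (stress g T n) z z *s z"
  using configD[OF cfg par] by (auto intro!: vector_eqI simp: bilin_stress)

text \<open>\<open>coords\<close> and \<open>emb\<close> intertwine the mixed tensor with the block,
  so the real form of a complex pair passes both ways, provided the transported vectors do not both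
  vanish.\<close>

lemma type_IV_config_iff:
  assumes cfg: "coupled_config g n x t z T"
  shows "type_IV g T \<longleftrightarrow> complex_pair (block (params_of g n x t T))"
proof -
  obtain \<rho> Sx Sy J m where par: "params_of g n x t T = (\<rho>, Sx, Sy, J, m)"
    by (metis prod_cases5)
  let ?M = "mixed g T" and ?B = "block (\<rho>, Sx, Sy, J, m)"
  note sym = configD(1)[OF cfg par]
  note M = mixed_config[OF cfg par]
  \<comment> \<open>Components along \<open>n\<close>, \<open>x\<close>, \<open>t\<close>,
    forgetting \<open>z\<close>; the minus sign is due to \<open>n\<close> being timelike.\<close>
  define coords :: "real^4 \<Rightarrow> real^3"
    where "coords v = vector [- bilin g n v, bilin g x v, bilin g t v]" for v
  define emb :: "real^3 \<Rightarrow> real^4"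
    where "emb c = c $ 1 *s n + c $ 2 *s x + c $ 3 *s t" for c
  \<comment> \<open>Self-adjointness moves the tensor onto the frame vectors, whose images are
    known.\<close>
  have coords_M: "coords (?M *v v) = ?B *v coords v" for v
    unfolding coords_def mixed_selfadjoint[OF sym] M
    by (simp add: vec_eq_iff forall_3 matrix_vector_mult_def sum_3)
  have coords_lin: "coords (a *s u + b *s v) = a *s coords u + b *s coords v"
    "coords (a *s u - b *s v) = a *s coords u - b *s coords v" for a b u v
    by (simp_all add: coords_def vec_eq_iff forall_3 algebra_simps)
  have emb_M: "?M *v emb c = emb (?B *v c)" for c
  proof -
    have "(?B *v c) $ 1 = - \<rho> * c $ 1 + J * c $ 2" "(?B *v c) $ 2 = - J * c $ 1 + Sx * c $ 2 + m * c $ 3"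
      "(?B *v c) $ 3 = m * c $ 2 + Sy * c $ 3"
      by (simp_all add: matrix_vector_mult_def sum_3)
    then show ?thesis
      by (simp only: emb_def matrix_vector_right_distrib vec.scale M)
        (simp add: vec_eq_iff algebra_simps)
  qed
  have emb_lin: "emb (a *s u + b *s v) = a *s emb u + b *s emb v"
    "emb (a *s u - b *s v) = a *s emb u - b *s emb v" for a b u v
    by (simp_all add: emb_def vec_eq_iff algebra_simps)
  have coords_emb: "coords (emb c) = c" for c
    by (simp add: coords_def emb_def vec_eq_iff forall_3)
  have coords_0: "coords 0 = 0"
    by (simp add: coords_def vec_eq_iff forall_3)
  show ?thesis unfolding par
  proof
    assume "type_IV g T"
    then obtain a b p q where b: "b \<noteq> 0" and nz: "p \<noteq> 0 \<or> q \<noteq> 0"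
      and p: "?M *v p = a *s p - b *s q" and q: "?M *v q = b *s p + a *s q"
      unfolding type_IV_def complex_pair_iff_real by blast
    have "?B *v coords p = a *s coords p - b *s coords q" "?B *v coords q = b *s coords p + a *s coords q"
      unfolding coords_M[symmetric] p q coords_lin by simp_all
    moreover have "coords p \<noteq> 0 \<or> coords q \<noteq> 0"
    proof -
      \<comment> \<open>Pairing with \<open>z\<close> turns the tensor into the real number
        \<open>?s\<close>. Eliminating \<open>?s\<close> and \<open>a\<close> shows that the
        \<open>z\<close>-components of \<open>p\<close> and \<open>q\<close> vanish, so
        \<open>coords\<close> cannot kill both vectors.\<close>
      let ?s = "bilin (stress g T n) z z" and ?u = "bilin g z p" and ?w = "bilin g z q"
      have "?s * ?u = a * ?u - b * ?w" "?s * ?w = b * ?u + a * ?w"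
        using mixed_selfadjoint[OF sym, of z p] mixed_selfadjoint[OF sym, of z q]
        unfolding p q M by simp_all
      then have "b * (?u * ?u + ?w * ?w) = 0" by algebra
      then have "?u = 0" "?w = 0" using b by auto
      then show ?thesis
        using nz vector_eqI[of p 0] vector_eqI[of q 0]
        by (auto simp: coords_def vec_eq_iff[where 'b=3] forall_3)
    qed
    ultimately show "complex_pair ?B"
      unfolding complex_pair_iff_real using b by blast
  next
    assume "complex_pair ?B"
    then obtain a b p q where b: "b \<noteq> 0" and nz: "p \<noteq> 0 \<or> q \<noteq> 0"
      and p: "?B *v p = a *s p - b *s q" and q: "?B *v q = b *s p + a *s q"
      unfolding complex_pair_iff_real by blast
    have "?M *v emb p = a *s emb p - b *s emb q" "?M *v emb q = b *s emb p + a *s emb q"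
      unfolding emb_M p q emb_lin by simp_all
    moreover have "emb p \<noteq> 0 \<or> emb q \<noteq> 0"
      using nz coords_emb coords_0 by metis
    ultimately show "type_IV g T"
      unfolding type_IV_def complex_pair_iff_real using b by blast
  qed
qed

section \<open>Realising prescribed parameters with a nonzero coupling\<close>

lemma config_exists:
  assumes J: "J > 0" and m: "m \<noteq> 0"
  obtains T where "coupled_config g n x t z T" "params_of g n x t T = (\<rho>, Sx, Sy, J, m)"
proof -
  let ?n = "g *v n" and ?x = "g *v x" and ?t = "g *v t"
  \<comment> \<open>Here \<open>J\<close> comes with a plus sign: as \<open>n\<close> is timelike,
    the component on \<open>n\<close> and \<open>x\<close> is \<open>- J\<close>, and the momentum
    becomes \<open>J *s x\<close>.\<close>
  define T where "T = \<rho> *\<^sub>R outer ?n ?n + J *\<^sub>R (outer ?n ?x + outer ?x ?n)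
    + Sx *\<^sub>R outer ?x ?x + m *\<^sub>R (outer ?x ?t + outer ?t ?x) + Sy *\<^sub>R outer ?t ?t"
  have sym: "transpose T = T"
    by (simp add: T_def transpose_def outer_def vec_eq_iff algebra_simps)
  have T: "bilin T v w = \<rho> * bilin g n v * bilin g n w
      + J * (bilin g n v * bilin g x w + bilin g x v * bilin g n w) + Sx * bilin g x v * bilin g x w
      + m * (bilin g x v * bilin g t w + bilin g t v * bilin g x w) + Sy * bilin g t v * bilin g t w"
    for v w
    unfolding T_def by (simp add: bilin_eq_inner[symmetric] metric_commute[of n v] metric_commute[of n w]
      metric_commute[of x v] metric_commute[of x w] metric_commute[of t v] metric_commute[of t w])
  have mom: "momentum g T n = J *s x"
    by (rule vector_eqI) (simp_all add: bilin_momentum[OF sym] energy_def T)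
  have norm: "momentum_norm g T n = J"
    using J by (simp add: momentum_norm_def bilin_spatial_metric mom)
  have x0: "x \<noteq> 0" using frame_products(2) by force
  have "momentum_dir g T n = x"
    using J by (simp add: momentum_dir_def norm mom vector_smult_assoc)
  moreover have "momentum g T n \<noteq> 0"
    using J x0 by (simp add: mom)
  moreover have "\<not> principal_axis g T n x"
  proof
    assume "principal_axis g T n x"
    then obtain \<mu> where "stress g T n *v x = \<mu> *s (spatial_metric g n *v x)"
      unfolding principal_axis_def by blast
    \<comment> \<open>Against \<open>t\<close> the spatial metric gives zero, whereas the stress
      gives \<open>m\<close>.\<close>
    then have "bilin (stress g T n) t x = \<mu> * bilin (spatial_metric g n) t x"
      by (simp add: bilin_eq_inner scalar_mult_eq_scaleR)
    then show False using m by (simp add: bilin_stress bilin_spatial_metric T)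
  qed
  ultimately have "coupled_config g n x t z T"
    using sym frame by (simp add: coupled_config_def bilin_stress T)
  moreover have "params_of g n x t T = (\<rho>, Sx, Sy, J, m)"
    by (simp add: params_of_def energy_def norm bilin_stress T)
  ultimately show thesis using that by blast
qed

end

theorem corollary1:
  fixes g T :: "real^4^4" and n x t z :: "real^4"
  assumes lorentz: "lorentzian g"
    and config: "coupled_config g n x t z T"
  shows
    "(\<forall>i. mixed g T *v ((vector [n, x, t] :: real^4^3) $ i) =
        (\<Sum>k\<in>UNIV. block (params_of g n x t T) $ k $ i *s ((vector [n, x, t] :: real^4^3) $ k)))
     \<and> mixed g T *v z = bilin (stress g T n) z z *s z
     \<and> bilin (stress g T n) x t \<noteq> 0 \<and>
     (\<forall>\<rho> Sx Sy J m. D (\<rho>, Sx, Sy, J, -m) = D (\<rho>, Sx, Sy, J, m)) \<and>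
     (\<forall>\<rho> Sx Sy J. D (\<rho>, Sx, Sy, J, 0) =
         (minor \<rho> Sx Sy J)\<^sup>2 * momentum_discriminant \<rho> Sx J) \<and>
     (complex_pair (block (params_of g n x t T)) \<longleftrightarrow> D (params_of g n x t T) < 0) \<and>
     (type_IV g T \<longleftrightarrow> D (params_of g n x t T) < 0) \<and>
     (frontier {p. complex_pair (block p)} \<subseteq> {p. D p = 0}) \<and>
     (\<exists>T' \<rho> Sx Sy J m. coupled_config g n x t z T' \<and> params_of g n x t T' = (\<rho>, Sx, Sy, J, m) \<and>
         momentum_discriminant \<rho> Sx J \<ge> 0 \<and> complex_pair (block (\<rho>, Sx, Sy, J, m)) \<and> type_IV g T') \<and>
     (\<forall>T'. transpose T' = T' \<and> momentum g T' n \<noteq> 0 \<and>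
         principal_axis g T' n (momentum_dir g T' n) \<and>
         momentum_discriminant (energy T' n)
           (bilin (stress g T' n) (momentum_dir g T' n) (momentum_dir g T' n))
           (momentum_norm g T' n) < 0
         \<longrightarrow> type_IV g T') \<and>
     (\<forall>\<rho> Sx J. J > 0 \<and> momentum_discriminant \<rho> Sx J \<ge> 0 \<longrightarrow>
         (\<exists>T' Sy m. coupled_config g n x t z T' \<and>
            params_of g n x t T' = (\<rho>, Sx, Sy, J, m) \<and> type_IV g T')) \<and>
     (\<forall>m. m \<noteq> 0 \<longrightarrow>
         (\<exists>T'. coupled_config g n x t z T' \<and> params_of g n x t T' = (1, 1, 0, 1/2, m))) \<and>
     (\<exists>m\<^sub>1 m\<^sub>2. m\<^sub>1 < m\<^sub>2 \<and> {m. 0 < m \<and> D (1, 1, 0, 1/2, m) = 0} = {m\<^sub>1, m\<^sub>2} \<and>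
         \<bar>m\<^sub>1 - 0.782\<bar> < 0.0005 \<and> \<bar>m\<^sub>2 - 2.015\<bar> < 0.0005 \<and>
         (\<forall>m. complex_pair (block (1, 1, 0, 1/2, m)) \<longleftrightarrow> m\<^sub>1 < \<bar>m\<bar> \<and> \<bar>m\<bar> < m\<^sub>2) \<and>
         (\<forall>T' m. coupled_config g n x t z T' \<and> params_of g n x t T' = (1, 1, 0, 1/2, m) \<longrightarrow>
            (type_IV g T' \<longleftrightarrow> m\<^sub>1 < \<bar>m\<bar> \<and> \<bar>m\<bar> < m\<^sub>2))) \<and>
     (\<forall>T'. coupled_config g n x t z T' \<and> params_of g n x t T' = (1, 1, 0, 1/2, 1) \<longrightarrow>
         (\<exists>s. bilin g n s = 0 \<and> bilin g s s = 1 \<and> bilin g (n + s) (n + s) = 0 \<and>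
              bilin T' (n + s) (n + s) < 0))"
proof -
  interpret orthonormal_tetrad g n x t z
    using lorentz config by (auto simp: orthonormal_tetrad_def lorentzian_def coupled_config_def)
  have type_IV_iff: "type_IV g T' \<longleftrightarrow> D (params_of g n x t T') < 0"
    if "coupled_config g n x t z T'" for T'
    by (simp only: type_IV_config_iff[OF that] complex_pair_block_iff)
  obtain \<rho> Sx Sy J m where par: "params_of g n x t T = (\<rho>, Sx, Sy, J, m)"
    by (metis prod_cases5)
  note M = mixed_config[OF config par]
  have block_action: "\<forall>i. mixed g T *v ((vector [n, x, t] :: real^4^3) $ i) =
      (\<Sum>k\<in>UNIV. block (params_of g n x t T) $ k $ i *s ((vector [n, x, t] :: real^4^3) $ k))"
    unfolding par forall_3 sum_3 by (simp add: M(1-3))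
  have coupling: "bilin (stress g T n) x t \<noteq> 0"
    using configD(2)[OF config par] par by (simp add: params_of_def)
  have D_one: "D (1, 1, 0, 1/2, 1) < 0"
    by (simp add: D_expand power2_eq_square power3_eq_cube)
  have open_pair: "\<exists>T' \<rho> Sx Sy J m. coupled_config g n x t z T' \<and>
      params_of g n x t T' = (\<rho>, Sx, Sy, J, m) \<and> momentum_discriminant \<rho> Sx J \<ge> 0 \<and>
      complex_pair (block (\<rho>, Sx, Sy, J, m)) \<and> type_IV g T'"
  proof -
    \<comment> \<open>The witness family at coupling 1: its momentum discriminant is 3, while
      \<open>D\<close> is negative.\<close>
    obtain T' where T': "coupled_config g n x t z T'" "params_of g n x t T' = (1, 1, 0, 1/2, 1)"
      by (rule config_exists[of "1/2" 1 1 1 0]) auto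
    moreover have "momentum_discriminant 1 1 (1/2) \<ge> 0"
      by (simp add: momentum_discriminant_def power2_eq_square)
    moreover have "type_IV g T'"
      unfolding type_IV_iff[OF T'(1)] T'(2) by (rule D_one)
    moreover have "complex_pair (block (1, 1, 0, 1/2, 1))"
      unfolding complex_pair_block_iff by (rule D_one)
    ultimately show ?thesis by blast
  qed
  have never_necessary: "\<exists>T' Sy m. coupled_config g n x t z T' \<and>
      params_of g n x t T' = (\<rho>, Sx, Sy, J, m) \<and> type_IV g T'"
    if hyp: "J > 0" "momentum_discriminant \<rho> Sx J \<ge> 0" for \<rho> Sx J
  proof -
    obtain Sy m where m: "m \<noteq> 0" "D (\<rho>, Sx, Sy, J, m) < 0"
      using D_neg_exists[OF hyp] .
    obtain T' where T': "coupled_config g n x t z T'" "params_of g n x t T' = (\<rho>, Sx, Sy, J, m)"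
      using config_exists[OF hyp(1) m(1)] .
    moreover have "type_IV g T'"
      unfolding type_IV_iff[OF T'(1)] T'(2) by (rule m(2))
    ultimately show ?thesis by blast
  qed
  have family: "\<exists>T'. coupled_config g n x t z T' \<and> params_of g n x t T' = (1, 1, 0, 1/2, m)"
    if "m \<noteq> 0" for m
    by (rule config_exists[of "1/2" m 1 1 0]) (use that in auto)
  have band: "\<exists>m\<^sub>1 m\<^sub>2. m\<^sub>1 < m\<^sub>2 \<and> {m. 0 < m \<and> D (1, 1, 0, 1/2, m) = 0} = {m\<^sub>1, m\<^sub>2} \<and>
      \<bar>m\<^sub>1 - 0.782\<bar> < 0.0005 \<and> \<bar>m\<^sub>2 - 2.015\<bar> < 0.0005 \<and>
      (\<forall>m. complex_pair (block (1, 1, 0, 1/2, m)) \<longleftrightarrow> m\<^sub>1 < \<bar>m\<bar> \<and> \<bar>m\<bar> < m\<^sub>2) \<and>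
      (\<forall>T' m. coupled_config g n x t z T' \<and> params_of g n x t T' = (1, 1, 0, 1/2, m) \<longrightarrow>
        (type_IV g T' \<longleftrightarrow> m\<^sub>1 < \<bar>m\<bar> \<and> \<bar>m\<bar> < m\<^sub>2))"
  proof -
    obtain m\<^sub>1 m\<^sub>2 where w: "m\<^sub>1 < m\<^sub>2" "{m. 0 < m \<and> D (1, 1, 0, 1/2, m) = 0} = {m\<^sub>1, m\<^sub>2}"
      "\<bar>m\<^sub>1 - 0.782\<bar> < 0.0005" "\<bar>m\<^sub>2 - 2.015\<bar> < 0.0005"
      and neg: "\<forall>m. D (1, 1, 0, 1/2, m) < 0 \<longleftrightarrow> m\<^sub>1 < \<bar>m\<bar> \<and> \<bar>m\<bar> < m\<^sub>2"
      using witness_band by (elim exE conjE)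
    have "\<forall>T' m. coupled_config g n x t z T' \<and> params_of g n x t T' = (1, 1, 0, 1/2, m) \<longrightarrow>
        (type_IV g T' \<longleftrightarrow> m\<^sub>1 < \<bar>m\<bar> \<and> \<bar>m\<bar> < m\<^sub>2)"
      unfolding neg[rule_format, symmetric] by (auto simp only: type_IV_iff)
    with w neg show ?thesis
      unfolding complex_pair_block_iff by (intro exI conjI)
  qed
  have null_violation: "\<exists>s. bilin g n s = 0 \<and> bilin g s s = 1 \<and> bilin g (n + s) (n + s) = 0 \<and>
      bilin T' (n + s) (n + s) < 0"
    if "coupled_config g n x t z T'" "params_of g n x t T' = (1, 1, 0, 1/2, 1)" for T'
    \<comment> \<open>A rational unit vector from the triple 3, 4, 5, tilted so that momentum and
      coupling both contribute negatively: \<open>1 - 3/5 + 9/25 - 24/25 = - 1/5\<close>.\<close>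
    using configD[OF that] by (intro exI[of _ "(3/5) *s x - (4/5) *s t"]) simp
  show ?thesis
    by (intro conjI allI impI block_action M(4) coupling D_even D_zero_coupling
        complex_pair_block_iff type_IV_iff[OF config] frontier_complex_pair_block open_pair band)
      (rule block_action[rule_format] principal_momentum_type_IV never_necessary family null_violation;
        (elim conjE)?; assumption)+
qed

end
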